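(* For any admissible matrix $U$ with $k$ columns we have $\dim(\mathbb{B}[\pmb x]/P[U])=r(U)$, where $r(U)$ is the number of rows of $U$ and $\mathbb{B}[\pmb x]$ is the $k$-variable polynomial semiring over $\mathbb{B}$.
   Context: A semiring is a commutative semiring with additive identity $0$ and multiplicative identity $1$, with $1\neq 0$ and $a\cdot 0=0$ for all $a$. $\mathbb{B}=\{0,1\}$ is the two-element semifield with $1+1=1$. For $\pmb x=(x_1,\dots,x_k)$, $\mathbb{B}[\pmb x]$ (resp. $\mathbb{B}(\pmb x)$) is the semiring of polynomials (resp. Laurent polynomials), i.e. formal finite sums of monomials $\pmb x^{\pmb n}$ with $\pmb n\in\mathbb{N}^k$ (resp. $\pmb n\in\mathbb{Z}^k$), where $0\in\mathbb{N}$, with coefficients in $\mathbb{B}$. A congruence of $A$ is an equivalence relation $I\subseteq A\times A$ compatible with addition and multiplication; it is proper if $I\ne A\times A$. A congruence $P$ is prime if it is proper and for all pairs $\alpha,\beta\in A\times A$ such that the twisted product $\alpha\beta=(\alpha_1\beta_1+\alpha_2\beta_2,\alpha_1\beta_2+\alpha_2\beta_1)$ is in $P$, we have $\alpha\in P$ or $\beta\in P$. $\dim(A)$ is the length (number of strict inclusions) of the longest chain of prime congruences of $A$. A real matrix $U$ with $k$ columns is admissible if for each row index $i$ there is $\pmb n\in\mathbb{Z}^k$ such that the first non-zero coordinate of $U\pmb n$ is the $i$-th one; the matrix with zero rows is allowed. (The rows of an admissible matrix are linearly independent, so $r(U)$ is also the rank of $U$.) $P(U)$ is the congruence of $\mathbb{B}(\pmb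 x)$ generated by the pairs $(\pmb x^{\pmb n_1}+\pmb x^{\pmb n_2},\pmb x^{\pmb n_2})$ such that $U(\pmb n_2-\pmb n_1)=\pmb 0$ or the first non-zero coordinate of $U(\pmb n_2-\pmb n_1)$ is positive, and $P[U]=P(U)\cap(\mathbb{B}[\pmb x]\times\mathbb{B}[\pmb x])$. *)

theory Defs
  imports
    "HOL-Library.Poly_Mapping"
    "HOL-Library.Extended_Real"
    "HOL-Algebra.Ring"
    "Jordan_Normal_Form.Matrix"
begin

text \<open>Semirings are structures \<open>A\<close> in the sense of the locale \<^locale>\<open>semiring\<close>, with explicit
  carrier; congruences are relations on the carrier.\<close>

definition congruence :: "('a, 'm) ring_scheme \<Rightarrow> ('a \<times> 'a) set \<Rightarrow> bool" where
  "congruence A I \<longleftrightarrow> equiv (carrier A) I \<and>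
    (\<forall>a b c d. (a, b) \<in> I \<longrightarrow> (c, d) \<in> I \<longrightarrow>
      (a \<oplus>\<^bsub>A\<^esub> c, b \<oplus>\<^bsub>A\<^esub> d) \<in> I \<and> (a \<otimes>\<^bsub>A\<^esub> c, b \<otimes>\<^bsub>A\<^esub> d) \<in> I)"

definition twisted_product ::
    "('a, 'm) ring_scheme \<Rightarrow> 'a \<times> 'a \<Rightarrow> 'a \<times> 'a \<Rightarrow> 'a \<times> 'a" where
  "twisted_product A \<alpha> \<beta> =
    ((fst \<alpha> \<otimes>\<^bsub>A\<^esub> fst \<beta>) \<oplus>\<^bsub>A\<^esub> (snd \<alpha> \<otimes>\<^bsub>A\<^esub> snd \<beta>),
     (fst \<alpha> \<otimes>\<^bsub>A\<^esub> snd \<beta>) \<oplus>\<^bsub>A\<^esub> (snd \<alpha> \<otimes>\<^bsub>A\<^esub> fst \<beta>))"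

definition prime_congruence :: "('a, 'm) ring_scheme \<Rightarrow> ('a \<times> 'a) set \<Rightarrow> bool" where
  "prime_congruence A P \<longleftrightarrow> congruence A P \<and> P \<noteq> carrier A \<times> carrier A \<and>
    (\<forall>\<alpha> \<in> carrier A \<times> carrier A. \<forall>\<beta> \<in> carrier A \<times> carrier A.
      twisted_product A \<alpha> \<beta> \<in> P \<longrightarrow> \<alpha> \<in> P \<or> \<beta> \<in> P)"

definition prime_chain :: "('a, 'm) ring_scheme \<Rightarrow> nat \<Rightarrow> (nat \<Rightarrow> ('a \<times> 'a) set) \<Rightarrow> bool" where
  "prime_chain A n C \<longleftrightarrow> (\<forall>i\<le>n. prime_congruence A (C i)) \<and> (\<forall>i<n. C i \<subset> C (Suc i))"

text \<open>Valued in \<^typ>\<open>ereal\<close>, so that the dimension is \<open>\<infinity>\<close> if there are arbitrarily long chains, and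
  \<open>-\<infinity>\<close> (rather than \<open>0\<close>) if there is no prime congruence at all. A finite value is attained by a
  chain, since the set of lengths consists of natural numbers.\<close>

definition congruence_dim :: "('a, 'm) ring_scheme \<Rightarrow> ereal" where
  "congruence_dim A = Sup {ereal (real n) | n. \<exists>C. prime_chain A n C}"

definition generated_congruence ::
    "('a, 'm) ring_scheme \<Rightarrow> ('a \<times> 'a) set \<Rightarrow> ('a \<times> 'a) set" where
  "generated_congruence A S = \<Inter>{I. congruence A I \<and> S \<subseteq> I}"

text \<open>The operations are those induced on representatives: for a congruence \<open>I\<close> the sets in the
  unions below all coincide.\<close>

definition quotient_semiring :: "('a, 'm) ring_scheme \<Rightarrow> ('a \<times> 'a) set \<Rightarrow> 'a set ring" where
  "quotient_semiring A I =
    \<lparr>carrier = carrier A // I,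
     mult = (\<lambda>X Y. \<Union>x\<in>X. \<Union>y\<in>Y. I `` {x \<otimes>\<^bsub>A\<^esub> y}),
     one = I `` {\<one>\<^bsub>A\<^esub>},
     zero = I `` {\<zero>\<^bsub>A\<^esub>},
     add = (\<lambda>X Y. \<Union>x\<in>X. \<Union>y\<in>Y. I `` {x \<oplus>\<^bsub>A\<^esub> y})\<rparr>"

datatype boolean_semifield = B0 | B1

instantiation boolean_semifield :: comm_semiring_1
begin

definition zero_boolean_semifield :: boolean_semifield where
  "0 = B0"

definition one_boolean_semifield :: boolean_semifield where
  "1 = B1"

definition plus_boolean_semifield ::
    "boolean_semifield \<Rightarrow> boolean_semifield \<Rightarrow> boolean_semifield" where
  "a + b = (if a = B0 \<and> b = B0 then B0 else B1)"

definition times_boolean_semifield ::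
    "boolean_semifield \<Rightarrow> boolean_semifield \<Rightarrow> boolean_semifield" where
  "a * b = (if a = B1 \<and> b = B1 then B1 else B0)"

instance
proof
  fix a b c :: boolean_semifield
  note defs = zero_boolean_semifield_def one_boolean_semifield_def
    plus_boolean_semifield_def times_boolean_semifield_def
  show "a + b + c = a + (b + c)" "a + b = b + a" "a * b * c = a * (b * c)" "a * b = b * a"
    "(a + b) * c = a * c + b * c"
    by (cases a; cases b; cases c; simp add: defs)+
  show "0 + a = a" "1 * a = a" "0 * a = 0" "a * 0 = 0"
    by (cases a; simp add: defs)+
  show "(0 :: boolean_semifield) \<noteq> 1"
    by (simp add: defs)
qed

end

text \<open>The \<open>k\<close> variables are indexed by \<open>0, \<dots>, k - 1\<close>, so this set is a copy of \<open>\<int>\<^sup>k\<close>.\<close>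

definition exponents :: "nat \<Rightarrow> (nat \<Rightarrow>\<^sub>0 int) set" where
  "exponents k = {n. Poly_Mapping.keys n \<subseteq> {..<k}}"

type_synonym laurent = "(nat \<Rightarrow>\<^sub>0 int) \<Rightarrow>\<^sub>0 boolean_semifield"

definition laurent_semiring :: "nat \<Rightarrow> laurent ring" where
  "laurent_semiring k =
    \<lparr>carrier = {p. Poly_Mapping.keys p \<subseteq> exponents k},
     mult = (*), one = 1, zero = 0, add = (+)\<rparr>"

text \<open>Polynomials are the Laurent polynomials with non-negative exponents, so that a congruence of
  the Laurent polynomials can be restricted to them by intersection.\<close>

definition polynomial_semiring :: "nat \<Rightarrow> laurent ring" where
  "polynomial_semiring k =
    \<lparr>carrier = {p. Poly_Mapping.keys p \<subseteq>
        {n \<in> exponents k. \<forall>i. 0 \<le> Poly_Mapping.lookup n i}},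
     mult = (*), one = 1, zero = 0, add = (+)\<rparr>"

abbreviation monomial :: "(nat \<Rightarrow>\<^sub>0 int) \<Rightarrow> laurent" where
  "monomial n \<equiv> Poly_Mapping.single n 1"

definition mat_mult_exponent :: "real mat \<Rightarrow> (nat \<Rightarrow>\<^sub>0 int) \<Rightarrow> real vec" where
  "mat_mult_exponent U n =
    U *\<^sub>v vec (dim_col U) (\<lambda>j. real_of_int (Poly_Mapping.lookup n j))"

definition first_nonzero_at :: "real vec \<Rightarrow> nat \<Rightarrow> bool" where
  "first_nonzero_at v i \<longleftrightarrow> i < dim_vec v \<and> v $ i \<noteq> 0 \<and> (\<forall>j<i. v $ j = 0)"

definition admissible :: "real mat \<Rightarrow> bool" where
  "admissible U \<longleftrightarrow>
    (\<forall>i<dim_row U. \<exists>n\<in>exponents (dim_col U). first_nonzero_at (mat_mult_exponent U n) i)"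

definition laurent_congruence :: "real mat \<Rightarrow> (laurent \<times> laurent) set" where
  "laurent_congruence U = generated_congruence (laurent_semiring (dim_col U))
    {(monomial n1 + monomial n2, monomial n2) | n1 n2.
      n1 \<in> exponents (dim_col U) \<and> n2 \<in> exponents (dim_col U) \<and>
      (let v = mat_mult_exponent U (n2 - n1)
       in v = 0\<^sub>v (dim_row U) \<or> (\<exists>i. first_nonzero_at v i \<and> 0 < v $ i))}"

definition polynomial_congruence :: "real mat \<Rightarrow> (laurent \<times> laurent) set" where
  "polynomial_congruence U = laurent_congruence U \<inter>
    (carrier (polynomial_semiring (dim_col U)) \<times> carrier (polynomial_semiring (dim_col U)))"

end

theory Submission
  imports Defs
begin

text \<open>Prime congruences of the quotient correspond to prime congruences of \<open>\<bbbB>[x]\<close> above \<open>P[U]\<close>.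
  The first \<open>s\<close> rows of \<open>U\<close> define a total preorder on exponents, and comparing leading monomials
  for it is a prime congruence; letting \<open>s\<close> decrease from the number of rows to \<open>0\<close> gives a chain.
  Conversely, modulo \<open>P[U]\<close> every non-zero polynomial is a monomial, so each strict inclusion
  \<open>P \<subset> P'\<close> of primes is witnessed by two monomials \<open>c < b\<close> outside the kernel of \<open>P\<close>, which \<open>P\<close>
  separates, and which \<open>P'\<close> either identifies outside its kernel, or for which \<open>b = 1\<close> and \<open>P'\<close> sends
  \<open>c\<close> to \<open>0\<close>. If the differences \<open>b - c\<close> and \<open>b' - c'\<close> of exponents at two steps were
  archimedean equivalent, then the smaller prime would already have identified \<open>b'\<close> and \<open>c'\<close> or
  sent \<open>c'\<close> to \<open>0\<close>. Hence the positions of the first non-zero coordinates of \<open>U (b - c)\<close> are pairwise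
  distinct along a chain, and its length is at most the number of rows.\<close>

section \<open>Prime congruences of a quotient\<close>

lemma congruenceD:
  assumes "congruence A I"
  shows congruence_equiv: "equiv (carrier A) I"
    and congruence_carrier: "(a, b) \<in> I \<Longrightarrow> a \<in> carrier A \<and> b \<in> carrier A"
    and congruence_refl: "a \<in> carrier A \<Longrightarrow> (a, a) \<in> I"
    and congruence_sym: "(a, b) \<in> I \<Longrightarrow> (b, a) \<in> I"
    and congruence_trans: "(a, b) \<in> I \<Longrightarrow> (b, c) \<in> I \<Longrightarrow> (a, c) \<in> I"
    and congruence_add: "(a, b) \<in> I \<Longrightarrow> (c, d) \<in> I \<Longrightarrow> (a \<oplus>\<^bsub>A\<^esub> c, b \<oplus>\<^bsub>A\<^esub> d) \<in> I"
    and congruence_mult: "(a, b) \<in> I \<Longrightarrow> (c, d) \<in> I \<Longrightarrow> (a \<otimes>\<^bsub>A\<^esub> c, b \<otimes>\<^bsub>A\<^esub> d) \<in> I"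
    and congruence_add_closed: "a \<in> carrier A \<Longrightarrow> c \<in> carrier A \<Longrightarrow> a \<oplus>\<^bsub>A\<^esub> c \<in> carrier A"
    and congruence_mult_closed: "a \<in> carrier A \<Longrightarrow> c \<in> carrier A \<Longrightarrow> a \<otimes>\<^bsub>A\<^esub> c \<in> carrier A"
proof -
  show e: "equiv (carrier A) I"
    using assms by (simp add: congruence_def)
  show c: "\<And>a b. (a, b) \<in> I \<Longrightarrow> a \<in> carrier A \<and> b \<in> carrier A"
    using equiv_type[OF e] by blast
  show r: "\<And>a. a \<in> carrier A \<Longrightarrow> (a, a) \<in> I"
    using e by (meson equiv_def refl_onD)
  show "(a, b) \<in> I \<Longrightarrow> (b, a) \<in> I"
    using e by (meson equiv_def symD)
  show "(a, b) \<in> I \<Longrightarrow> (b, c) \<in> I \<Longrightarrow> (a, c) \<in> I"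
    using e by (meson equiv_def transD)
  show a: "\<And>a b c d. (a, b) \<in> I \<Longrightarrow> (c, d) \<in> I \<Longrightarrow> (a \<oplus>\<^bsub>A\<^esub> c, b \<oplus>\<^bsub>A\<^esub> d) \<in> I"
    and m: "\<And>a b c d. (a, b) \<in> I \<Longrightarrow> (c, d) \<in> I \<Longrightarrow> (a \<otimes>\<^bsub>A\<^esub> c, b \<otimes>\<^bsub>A\<^esub> d) \<in> I"
    using assms by (auto simp: congruence_def)
  show "a \<in> carrier A \<Longrightarrow> c \<in> carrier A \<Longrightarrow> a \<oplus>\<^bsub>A\<^esub> c \<in> carrier A"
    using a c r by blast
  show "a \<in> carrier A \<Longrightarrow> c \<in> carrier A \<Longrightarrow> a \<otimes>\<^bsub>A\<^esub> c \<in> carrier A"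
    using m c r by blast
qed

lemma congruenceI:
  assumes "I \<subseteq> carrier A \<times> carrier A"
    and "\<And>a. a \<in> carrier A \<Longrightarrow> (a, a) \<in> I"
    and "\<And>a b. (a, b) \<in> I \<Longrightarrow> (b, a) \<in> I"
    and "\<And>a b c. (a, b) \<in> I \<Longrightarrow> (b, c) \<in> I \<Longrightarrow> (a, c) \<in> I"
    and "\<And>a b c d. (a, b) \<in> I \<Longrightarrow> (c, d) \<in> I \<Longrightarrow> (a \<oplus>\<^bsub>A\<^esub> c, b \<oplus>\<^bsub>A\<^esub> d) \<in> I"
    and "\<And>a b c d. (a, b) \<in> I \<Longrightarrow> (c, d) \<in> I \<Longrightarrow> (a \<otimes>\<^bsub>A\<^esub> c, b \<otimes>\<^bsub>A\<^esub> d) \<in> I"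
  shows "congruence A I"
  unfolding congruence_def
proof (intro conjI allI impI)
  show "equiv (carrier A) I"
  proof (rule equivI)
    show "refl_on (carrier A) I"
      using assms(2) by (simp add: refl_on_def)
    show "sym I"
      using assms(3) by (rule symI)
    show "trans I"
      using assms(4) by (rule transI)
  qed (fact assms(1))
qed (auto intro: assms(5,6))

lemma quotient_semiring_carrier: "carrier (quotient_semiring A I) = carrier A // I"
  by (simp add: quotient_semiring_def)

context
  fixes A :: "('a, 'm) ring_scheme" and I :: "('a \<times> 'a) set"
  assumes I: "congruence A I"
begin

private abbreviation (input) cls :: "'a \<Rightarrow> 'a set" where "cls x \<equiv> I `` {x}"
private abbreviation (input) "Q \<equiv> quotient_semiring A I"

lemma quotient_class_eq_iff:
  "x \<in> carrier A \<Longrightarrow> y \<in> carrier A \<Longrightarrow> cls x = cls y \<longleftrightarrow> (x, y) \<in> I"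
  by (rule eq_equiv_class_iff[OF congruence_equiv[OF I]])

lemma quotient_class_carrier: "x \<in> carrier A \<Longrightarrow> cls x \<in> carrier Q"
  unfolding quotient_semiring_carrier by (rule quotientI)

lemma quotient_classE:
  assumes "X \<in> carrier Q"
  obtains x where "x \<in> carrier A" "X = cls x"
  using assms unfolding quotient_semiring_carrier by (rule quotientE)

text \<open>All representatives give the same class because \<open>f\<close> respects
  \<open>I\<close>, and the index sets are non-empty by reflexivity, so the union collapses.\<close>

lemma quotient_class_op:
  assumes x: "x \<in> carrier A" and y: "y \<in> carrier A"
    and f: "\<And>a b c d. (a, b) \<in> I \<Longrightarrow> (c, d) \<in> I \<Longrightarrow> (f a c, f b d) \<in> I"
  shows "(\<Union>u\<in>cls x. \<Union>v\<in>cls y. cls (f u v)) = cls (f x y)"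
proof -
  have "cls (f u v) = cls (f x y)" if "u \<in> cls x" "v \<in> cls y" for u v
    using that f[of x u y v] equiv_class_eq[OF congruence_equiv[OF I]] by blast
  moreover have "x \<in> cls x" "y \<in> cls y"
    using x y congruence_refl[OF I] by blast+
  ultimately show ?thesis
    by blast
qed

lemma quotient_class_add:
  "x \<in> carrier A \<Longrightarrow> y \<in> carrier A \<Longrightarrow> cls x \<oplus>\<^bsub>Q\<^esub> cls y = cls (x \<oplus>\<^bsub>A\<^esub> y)"
  unfolding quotient_semiring_def ring_record_simps
  by (rule quotient_class_op) (auto intro: congruence_add[OF I])

lemma quotient_class_mult:
  "x \<in> carrier A \<Longrightarrow> y \<in> carrier A \<Longrightarrow> cls x \<otimes>\<^bsub>Q\<^esub> cls y = cls (x \<otimes>\<^bsub>A\<^esub> y)"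
  unfolding quotient_semiring_def monoid.simps
  by (rule quotient_class_op) (auto intro: congruence_mult[OF I])

lemmas quotient_simps = quotient_class_add quotient_class_mult quotient_class_carrier
  congruence_add_closed[OF I] congruence_mult_closed[OF I]

section \<open>Transfer of prime congruences along the class map\<close>

definition pullback_congruence :: "('a set \<times> 'a set) set \<Rightarrow> ('a \<times> 'a) set" where
  "pullback_congruence C = {(x, y) \<in> carrier A \<times> carrier A. (cls x, cls y) \<in> C}"

definition pushforward_congruence :: "('a \<times> 'a) set \<Rightarrow> ('a set \<times> 'a set) set" where
  "pushforward_congruence D = {(X, Y). \<exists>(x, y) \<in> D. X = cls x \<and> Y = cls y}"

text \<open>The class map is a homomorphism, so it commutes with twisted products; being onto, it
  pulls proper congruences back to proper ones.\<close>

lemma prime_pullback_congruence: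
  assumes C: "prime_congruence Q C"
  shows "prime_congruence A (pullback_congruence C)"
  unfolding prime_congruence_def
proof (intro conjI ballI impI)
  have Cc: "congruence Q C" and proper: "C \<noteq> carrier Q \<times> carrier Q"
    using C by (auto simp: prime_congruence_def)
  show "congruence A (pullback_congruence C)"
    by (rule congruenceI)
      (auto simp: pullback_congruence_def quotient_simps
        simp flip: quotient_class_add quotient_class_mult
        intro: congruence_refl[OF Cc] congruence_sym[OF Cc] congruence_trans[OF Cc]
          congruence_add[OF Cc] congruence_mult[OF Cc])
  show "pullback_congruence C \<noteq> carrier A \<times> carrier A"
  proof
    assume *: "pullback_congruence C = carrier A \<times> carrier A"
    have "(X, Y) \<in> C" if X: "X \<in> carrier Q" and Y: "Y \<in> carrier Q" for X Y
    proof -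
      obtain x y where "x \<in> carrier A" "X = cls x" "y \<in> carrier A" "Y = cls y"
        using X Y by (elim quotient_classE)
      then show ?thesis
        using * by (auto simp: pullback_congruence_def)
    qed
    then have "C = carrier Q \<times> carrier Q"
      using congruence_carrier[OF Cc] by auto
    with proper show False ..
  qed
next
  fix \<alpha> \<beta>
  assume \<alpha>: "\<alpha> \<in> carrier A \<times> carrier A" and \<beta>: "\<beta> \<in> carrier A \<times> carrier A"
    and tw: "twisted_product A \<alpha> \<beta> \<in> pullback_congruence C"
  obtain a b c d where ab: "\<alpha> = (a, b)" "\<beta> = (c, d)"
    by (cases \<alpha>, cases \<beta>)
  have car: "a \<in> carrier A" "b \<in> carrier A" "c \<in> carrier A" "d \<in> carrier A"
    using \<alpha> \<beta> ab by auto
  have "twisted_product Q (cls a, cls b) (cls c, cls d) \<in> C"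
    using tw car by (simp add: ab twisted_product_def pullback_congruence_def quotient_simps)
  moreover have "(cls a, cls b) \<in> carrier Q \<times> carrier Q" "(cls c, cls d) \<in> carrier Q \<times> carrier Q"
    using car by (auto simp: quotient_simps)
  ultimately have "(cls a, cls b) \<in> C \<or> (cls c, cls d) \<in> C"
    using C unfolding prime_congruence_def by blast
  then show "\<alpha> \<in> pullback_congruence C \<or> \<beta> \<in> pullback_congruence C"
    using car by (auto simp: ab pullback_congruence_def)
qed

lemma pullback_congruence_contains:
  assumes C: "congruence Q C"
  shows "I \<subseteq> pullback_congruence C"
proof (rule subrelI)
  fix x y
  assume xy: "(x, y) \<in> I"
  then have car: "x \<in> carrier A" "y \<in> carrier A"
    using congruence_carrier[OF I] by auto
  then have "cls x = cls y"
    using xy quotient_class_eq_iff by blast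
  then show "(x, y) \<in> pullback_congruence C"
    using car congruence_refl[OF C] by (auto simp: pullback_congruence_def quotient_simps)
qed

lemma pullback_congruence_strict_mono:
  assumes C: "congruence Q C" "congruence Q D" and "C \<subset> D"
  shows "pullback_congruence C \<subset> pullback_congruence D"
proof -
  obtain X Y where XY: "(X, Y) \<in> D" "(X, Y) \<notin> C"
    using \<open>C \<subset> D\<close> by auto
  then have "X \<in> carrier Q" "Y \<in> carrier Q"
    using congruence_carrier[OF C(2)] by auto
  then obtain x y where "x \<in> carrier A" "X = cls x" "y \<in> carrier A" "Y = cls y"
    by (elim quotient_classE)
  then have "(x, y) \<in> pullback_congruence D" "(x, y) \<notin> pullback_congruence C"
    using XY by (auto simp: pullback_congruence_def)
  then show ?thesis
    using \<open>C \<subset> D\<close> by (auto simp: pullback_congruence_def)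
qed

context
  fixes D
  assumes D: "congruence A D" and ID: "I \<subseteq> D"
begin

text \<open>Since \<open>D\<close> contains \<open>I\<close>, membership in \<open>D\<close> does
  not depend on the representatives chosen modulo \<open>I\<close>.\<close>

lemma pushforward_congruence_iff:
  assumes "x \<in> carrier A" "y \<in> carrier A"
  shows "(cls x, cls y) \<in> pushforward_congruence D \<longleftrightarrow> (x, y) \<in> D"
proof
  assume "(cls x, cls y) \<in> pushforward_congruence D"
  then obtain u v where uv: "(u, v) \<in> D" "cls x = cls u" "cls y = cls v"
    by (auto simp: pushforward_congruence_def)
  then have "u \<in> carrier A" "v \<in> carrier A"
    using congruence_carrier[OF D] by auto
  then have "(x, u) \<in> D" "(v, y) \<in> D"
    using uv assms ID quotient_class_eq_iff congruence_sym[OF I] by blast+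
  then show "(x, y) \<in> D"
    using uv congruence_trans[OF D] by blast
qed (auto simp: pushforward_congruence_def)

lemma pushforward_congruence_carrier:
  "pushforward_congruence D \<subseteq> carrier Q \<times> carrier Q"
  using congruence_carrier[OF D] by (auto simp: pushforward_congruence_def quotient_simps)

lemma congruence_pushforward: "congruence Q (pushforward_congruence D)"
proof (rule congruenceI)
  show "pushforward_congruence D \<subseteq> carrier Q \<times> carrier Q"
    by (fact pushforward_congruence_carrier)
  have cl: "X \<in> carrier Q" "Y \<in> carrier Q" if "(X, Y) \<in> pushforward_congruence D" for X Y
    using that pushforward_congruence_carrier by auto
  show "(X, X) \<in> pushforward_congruence D" if "X \<in> carrier Q" for X
    using that congruence_refl[OF D]
    by (elim quotient_classE) (simp add: pushforward_congruence_iff)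
  show "(Y, X) \<in> pushforward_congruence D" if "(X, Y) \<in> pushforward_congruence D" for X Y
    using that congruence_sym[OF D] by (auto simp: pushforward_congruence_def)
  show "(X, Z) \<in> pushforward_congruence D"
    if *: "(X, Y) \<in> pushforward_congruence D" "(Y, Z) \<in> pushforward_congruence D" for X Y Z
  proof -
    obtain x y z where "x \<in> carrier A" "X = cls x" "y \<in> carrier A" "Y = cls y"
      "z \<in> carrier A" "Z = cls z"
      using *[THEN cl(1)] *[THEN cl(2)] by (elim quotient_classE)
    then show ?thesis
      using * congruence_trans[OF D] by (auto simp: pushforward_congruence_iff)
  qed
  fix X Y Z W
  assume *: "(X, Y) \<in> pushforward_congruence D" "(Z, W) \<in> pushforward_congruence D"
  then obtain x y z w where xs: "x \<in> carrier A" "X = cls x" "y \<in> carrier A" "Y = cls y"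
    "z \<in> carrier A" "Z = cls z" "w \<in> carrier A" "W = cls w"
    using *[THEN cl(1)] *[THEN cl(2)] by (elim quotient_classE)
  then have "(x, y) \<in> D" "(z, w) \<in> D"
    using * by (auto simp: pushforward_congruence_iff)
  then show "(X \<oplus>\<^bsub>Q\<^esub> Z, Y \<oplus>\<^bsub>Q\<^esub> W) \<in> pushforward_congruence D"
    "(X \<otimes>\<^bsub>Q\<^esub> Z, Y \<otimes>\<^bsub>Q\<^esub> W) \<in> pushforward_congruence D"
    using xs congruence_add[OF D] congruence_mult[OF D]
    by (auto simp: quotient_simps pushforward_congruence_iff)
qed

lemma prime_pushforward_congruence:
  assumes P: "prime_congruence A D"
  shows "prime_congruence Q (pushforward_congruence D)"
  unfolding prime_congruence_def
proof (intro conjI ballI impI)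
  show "congruence Q (pushforward_congruence D)"
    by (fact congruence_pushforward)
  show "pushforward_congruence D \<noteq> carrier Q \<times> carrier Q"
  proof
    assume *: "pushforward_congruence D = carrier Q \<times> carrier Q"
    have "(x, y) \<in> D" if "x \<in> carrier A" "y \<in> carrier A" for x y
      using that pushforward_congruence_iff[OF that] by (simp add: * quotient_class_carrier)
    then have "D = carrier A \<times> carrier A"
      using congruence_carrier[OF D] by auto
    with P show False
      by (simp add: prime_congruence_def)
  qed
next
  fix \<alpha> \<beta>
  assume \<alpha>: "\<alpha> \<in> carrier Q \<times> carrier Q" and \<beta>: "\<beta> \<in> carrier Q \<times> carrier Q"
    and tw: "twisted_product Q \<alpha> \<beta> \<in> pushforward_congruence D"
  obtain X Y Z W where XY: "\<alpha> = (X, Y)" "\<beta> = (Z, W)"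
    by (cases \<alpha>, cases \<beta>)
  then obtain x y z w where xs: "x \<in> carrier A" "X = cls x" "y \<in> carrier A" "Y = cls y"
    "z \<in> carrier A" "Z = cls z" "w \<in> carrier A" "W = cls w"
    using \<alpha> \<beta> by (auto elim!: quotient_classE)
  have "twisted_product A (x, y) (z, w) \<in> D"
    using tw xs by (simp add: XY twisted_product_def quotient_simps pushforward_congruence_iff)
  then have "(x, y) \<in> D \<or> (z, w) \<in> D"
    using P xs unfolding prime_congruence_def by blast
  then show "\<alpha> \<in> pushforward_congruence D \<or> \<beta> \<in> pushforward_congruence D"
    using xs by (simp add: XY pushforward_congruence_iff)
qed

end

lemma pushforward_congruence_strict_mono:
  assumes C: "congruence A C" "I \<subseteq> C" and D: "congruence A D" and "C \<subset> D"
  shows "pushforward_congruence C \<subset> pushforward_congruence D"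
proof -
  obtain x y where xy: "(x, y) \<in> D" "(x, y) \<notin> C"
    using \<open>C \<subset> D\<close> by auto
  then have "x \<in> carrier A" "y \<in> carrier A"
    using congruence_carrier[OF D] by auto
  then have "(cls x, cls y) \<in> pushforward_congruence D" "(cls x, cls y) \<notin> pushforward_congruence C"
    using xy C D \<open>C \<subset> D\<close> pushforward_congruence_iff by (blast, blast)
  moreover have "pushforward_congruence C \<subseteq> pushforward_congruence D"
    using \<open>C \<subset> D\<close> unfolding pushforward_congruence_def by fast
  ultimately show ?thesis
    by blast
qed

lemma prime_chain_subset:
  assumes "prime_chain B n C" "i \<le> j" "j \<le> n"
  shows "C i \<subseteq> C j"
  using assms(2,3)
proof (induction j)
  case (Suc j)
  then have "C j \<subset> C (Suc j)"
    using assms(1) by (simp add: prime_chain_def)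
  then show ?case
    using Suc by (auto simp: le_Suc_eq)
qed simp

text \<open>Pulling back and pushing forward preserve primality and strict inclusion. A condition on
  \<open>C 0\<close> suffices because chains increase.\<close>

lemma prime_chain_quotient_iff:
  "(\<exists>C. prime_chain Q n C) \<longleftrightarrow> (\<exists>C. prime_chain A n C \<and> I \<subseteq> C 0)"
proof safe
  fix C
  assume C: "prime_chain Q n C"
  then have pr: "prime_congruence Q (C i)" "congruence Q (C i)" if "i \<le> n" for i
    using that by (auto simp: prime_chain_def prime_congruence_def)
  have "prime_chain A n (\<lambda>i. pullback_congruence (C i))"
    unfolding prime_chain_def
    using C pr prime_pullback_congruence pullback_congruence_strict_mono
    by (simp add: prime_chain_def)
  moreover have "I \<subseteq> pullback_congruence (C 0)"
    using pr pullback_congruence_contains by blast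
  ultimately show "\<exists>C. prime_chain A n C \<and> I \<subseteq> C 0"
    by blast
next
  fix C
  assume C: "prime_chain A n C" and I0: "I \<subseteq> C 0"
  then have pr: "prime_congruence A (C i)" "congruence A (C i)" if "i \<le> n" for i
    using that by (auto simp: prime_chain_def prime_congruence_def)
  have IC: "I \<subseteq> C i" if "i \<le> n" for i
    using I0 prime_chain_subset[OF C, of 0 i] that by auto
  have "prime_chain Q n (\<lambda>i. pushforward_congruence (C i))"
    unfolding prime_chain_def
    using C pr IC prime_pushforward_congruence pushforward_congruence_strict_mono
    by (simp add: prime_chain_def)
  then show "\<exists>C. prime_chain Q n C"
    by blast
qed

end

section \<open>Semirings of Boolean polynomials\<close>

lemma boolean_semifield_add_eq_0_iff: "(a :: boolean_semifield) + b = 0 \<longleftrightarrow> a = 0 \<and> b = 0"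
  by (auto simp: plus_boolean_semifield_def zero_boolean_semifield_def)

lemma boolean_semifield_one_add: "1 + (a :: boolean_semifield) = 1"
  by (simp add: plus_boolean_semifield_def one_boolean_semifield_def)

lemma boolean_semifield_eq_1_iff: "(a :: boolean_semifield) = 1 \<longleftrightarrow> a \<noteq> 0"
  by (cases a) (auto simp: zero_boolean_semifield_def one_boolean_semifield_def)

text \<open>No cancellation occurs: a sum in the Boolean semifield vanishes only if both summands
  do.\<close>

lemma keys_laurent_add:
  "Poly_Mapping.keys ((f :: laurent) + g) = Poly_Mapping.keys f \<union> Poly_Mapping.keys g"
  by (auto simp: in_keys_iff lookup_add boolean_semifield_add_eq_0_iff)

lemma monomial_add_absorb:
  assumes "n \<in> Poly_Mapping.keys (f :: laurent)"
  shows "monomial n + f = f"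
  using assms
  by (intro poly_mapping_eqI)
    (auto simp: lookup_add lookup_single in_keys_iff when_def boolean_semifield_one_add
      boolean_semifield_eq_1_iff)

lemma keys_laurent_mult:
  "Poly_Mapping.keys ((f :: laurent) * g) =
    {a + b | a b. a \<in> Poly_Mapping.keys f \<and> b \<in> Poly_Mapping.keys g}"
proof (intro equalityI keys_mult subsetI)
  fix n
  assume "n \<in> {a + b | a b. a \<in> Poly_Mapping.keys f \<and> b \<in> Poly_Mapping.keys g}"
  then obtain a b where n: "n = a + b"
    and ab: "a \<in> Poly_Mapping.keys f" "b \<in> Poly_Mapping.keys g"
    by blast
  \<comment> \<open>Absorption exposes \<open>monomial a\<close> and \<open>monomial b\<close> as
    summands of the factors, so \<open>monomial n\<close> is a summand of the product and cannot
    cancel.\<close>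
  have "f * g = (monomial a + f) * (monomial b + g)"
    using ab by (simp only: monomial_add_absorb)
  also have "\<dots> = monomial n + (monomial a * g + f * monomial b + f * g)"
    by (simp add: n mult_single algebra_simps)
  finally show "n \<in> Poly_Mapping.keys (f * g)"
    by (metis UnI1 keys_laurent_add keys_single singletonI zero_neq_one)
qed

lemma monomial_mult: "monomial a * monomial b = monomial (a + b)"
  by (simp add: mult_single)

text \<open>Common form of the Laurent and the polynomial semiring, so that both are treated at
  once.\<close>

definition monomial_semiring :: "(nat \<Rightarrow>\<^sub>0 int) set \<Rightarrow> laurent ring" where
  "monomial_semiring E =
    \<lparr>carrier = {p. Poly_Mapping.keys p \<subseteq> E}, mult = (*), one = 1, zero = 0, add = (+)\<rparr>"

lemma monomial_semiring_simps [simp]: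
  "f \<in> carrier (monomial_semiring E) \<longleftrightarrow> Poly_Mapping.keys f \<subseteq> E"
  "f \<oplus>\<^bsub>monomial_semiring E\<^esub> g = f + g"
  "f \<otimes>\<^bsub>monomial_semiring E\<^esub> g = f * g"
  by (simp_all add: monomial_semiring_def)

locale exponent_monoid =
  fixes E :: "(nat \<Rightarrow>\<^sub>0 int) set"
  assumes zero_exponent: "0 \<in> E"
    and add_exponent: "a \<in> E \<Longrightarrow> b \<in> E \<Longrightarrow> a + b \<in> E"
begin

abbreviation (input) "A \<equiv> monomial_semiring E"

text \<open>The left factor is a constant of the ring \<open>nat \<Rightarrow>\<^sub>0 int\<close>,
  so this product is the \<open>m\<close>-fold sum of \<open>a\<close>.\<close>

lemma scale_exponent: "a \<in> E \<Longrightarrow> of_nat m * a \<in> E"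
  by (induction m) (auto simp: zero_exponent add_exponent distrib_right)

lemma laurent_add_closed:
  "Poly_Mapping.keys (f :: laurent) \<subseteq> E \<Longrightarrow> Poly_Mapping.keys g \<subseteq> E \<Longrightarrow>
    Poly_Mapping.keys (f + g) \<subseteq> E"
  by (auto simp: keys_laurent_add)

lemma laurent_mult_closed:
  "Poly_Mapping.keys (f :: laurent) \<subseteq> E \<Longrightarrow> Poly_Mapping.keys g \<subseteq> E \<Longrightarrow>
    Poly_Mapping.keys (f * g) \<subseteq> E"
  by (auto simp: keys_laurent_mult intro: add_exponent)

end

section \<open>Congruences of total group preorders\<close>

text \<open>A cone \<open>N\<close> encodes the translation-invariant total preorder in which \<open>a\<close> is below \<open>b\<close> iff
  \<open>b - a \<in> N\<close>.\<close>

locale exponent_cone =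
  fixes N :: "(nat \<Rightarrow>\<^sub>0 int) set"
  assumes cone_zero: "0 \<in> N"
    and cone_add: "a \<in> N \<Longrightarrow> b \<in> N \<Longrightarrow> a + b \<in> N"
    and cone_total: "a \<in> N \<or> - a \<in> N"
begin

lemma cone_trans: "b - a \<in> N \<Longrightarrow> c - b \<in> N \<Longrightarrow> c - a \<in> N"
  using cone_add[of "b - a" "c - b"] by simp

lemma cone_linear: "b - a \<in> N \<or> a - b \<in> N"
  using cone_total[of "b - a"] by simp

lemma cone_greatest:
  assumes "finite S" "S \<noteq> {}"
  shows "\<exists>m\<in>S. \<forall>n\<in>S. m - n \<in> N"
  using assms
proof (induction S rule: finite_ne_induct)
  case (insert x S)
  then obtain m where m: "m \<in> S" "\<forall>n\<in>S. m - n \<in> N"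
    by blast
  show ?case
  proof (cases "m - x \<in> N")
    case False
    then have "x - m \<in> N"
      using cone_linear by blast
    then have "\<forall>n\<in>S. x - n \<in> N"
      using m(2) cone_trans by blast
    then show ?thesis
      using cone_zero by auto
  qed (use m in blast)
qed (simp add: cone_zero)

end

text \<open>For a cone this compares leading exponents. Quantifying over supports avoids choosing
  one, which a preorder does not make unique, and covers 0, which is dominated by
  everything.\<close>

definition dominated :: "(nat \<Rightarrow>\<^sub>0 int) set \<Rightarrow> laurent \<Rightarrow> laurent \<Rightarrow> bool" where
  "dominated N f g \<longleftrightarrow> (\<forall>n\<in>Poly_Mapping.keys f. \<exists>m\<in>Poly_Mapping.keys g. m - n \<in> N)"

text \<open>When \<open>N\<close> is a cone, non-zero polynomials are related iff their leading
  exponents are equivalent, while 0 is related only to itself.\<close>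

definition cone_congruence ::
    "(nat \<Rightarrow>\<^sub>0 int) set \<Rightarrow> (nat \<Rightarrow>\<^sub>0 int) set \<Rightarrow> (laurent \<times> laurent) set" where
  "cone_congruence E N = {(f, g). Poly_Mapping.keys f \<subseteq> E \<and> Poly_Mapping.keys g \<subseteq> E \<and>
    dominated N f g \<and> dominated N g f}"

lemma cone_congruence_mono: "N \<subseteq> N' \<Longrightarrow> cone_congruence E N \<subseteq> cone_congruence E N'"
  unfolding cone_congruence_def dominated_def by blast

lemma monomial_cone_congruence_iff:
  "(monomial a, monomial b) \<in> cone_congruence E N \<longleftrightarrow>
    a \<in> E \<and> b \<in> E \<and> b - a \<in> N \<and> a - b \<in> N"
  by (auto simp: cone_congruence_def dominated_def)

context exponent_cone
begin

lemma dominated_refl: "dominated N f f"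
  using cone_zero by (force simp: dominated_def)

lemma dominated_trans: "dominated N f g \<Longrightarrow> dominated N g h \<Longrightarrow> dominated N f h"
  unfolding dominated_def by (meson cone_trans)

lemma dominated_add: "dominated N f g \<Longrightarrow> dominated N f' g' \<Longrightarrow> dominated N (f + f') (g + g')"
  by (auto simp: dominated_def keys_laurent_add)

lemma dominated_mult:
  assumes "dominated N f g" "dominated N f' g'"
  shows "dominated N (f * f') (g * g')"
  unfolding dominated_def
proof
  fix n
  assume "n \<in> Poly_Mapping.keys (f * f')"
  then obtain a b where n: "n = a + b" and "a \<in> Poly_Mapping.keys f" "b \<in> Poly_Mapping.keys f'"
    by (auto simp: keys_laurent_mult)
  then obtain c d where c: "c \<in> Poly_Mapping.keys g" "c - a \<in> N"
    and d: "d \<in> Poly_Mapping.keys g'" "d - b \<in> N"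
    using assms unfolding dominated_def by blast
  have "c + d - n \<in> N"
    using cone_add[OF c(2) d(2)] by (simp add: n algebra_simps)
  moreover have "c + d \<in> Poly_Mapping.keys (g * g')"
    using c d by (auto simp: keys_laurent_mult)
  ultimately show "\<exists>m\<in>Poly_Mapping.keys (g * g'). m - n \<in> N"
    by blast
qed

text \<open>A greatest exponent of \<open>f\<close> works: it lies above an exponent that none of
  \<open>g\<close> reaches.\<close>

lemma not_dominatedE:
  assumes "\<not> dominated N f g"
  obtains n where "n \<in> Poly_Mapping.keys f" "\<And>m. m \<in> Poly_Mapping.keys f \<Longrightarrow> n - m \<in> N"
    "\<And>m. m \<in> Poly_Mapping.keys g \<Longrightarrow> m - n \<notin> N"
proof -
  obtain n0 where n0: "n0 \<in> Poly_Mapping.keys f" "\<forall>m\<in>Poly_Mapping.keys g. m - n0 \<notin> N"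
    using assms by (auto simp: dominated_def)
  then obtain n where n: "n \<in> Poly_Mapping.keys f" "\<forall>m\<in>Poly_Mapping.keys f. n - m \<in> N"
    using cone_greatest[OF finite_keys] by blast
  have "m - n \<notin> N" if "m \<in> Poly_Mapping.keys g" for m
    using that n0 n cone_trans by blast
  with n that show thesis
    by blast
qed

text \<open>The product of the two leading monomials dominates strictly every other monomial.\<close>

lemma not_dominated_twisted:
  assumes "\<not> dominated N f g" "\<not> dominated N f' g'"
  shows "\<not> dominated N (f * f' + g * g') (f * g' + g * f')"
proof
  assume dom: "dominated N (f * f' + g * g') (f * g' + g * f')"
  obtain n where n: "n \<in> Poly_Mapping.keys f" "\<And>m. m \<in> Poly_Mapping.keys f \<Longrightarrow> n - m \<in> N"
    "\<And>m. m \<in> Poly_Mapping.keys g \<Longrightarrow> m - n \<notin> N"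
    using assms(1) not_dominatedE by blast
  obtain p where p: "p \<in> Poly_Mapping.keys f'" "\<And>m. m \<in> Poly_Mapping.keys f' \<Longrightarrow> p - m \<in> N"
    "\<And>m. m \<in> Poly_Mapping.keys g' \<Longrightarrow> m - p \<notin> N"
    using assms(2) not_dominatedE by blast
  have "n + p \<in> Poly_Mapping.keys (f * f' + g * g')"
    using n p by (auto simp: keys_laurent_add keys_laurent_mult)
  then obtain q where "q \<in> Poly_Mapping.keys (f * g' + g * f')" "q - (n + p) \<in> N"
    using dom unfolding dominated_def by blast
  then consider (left) a b where "a \<in> Poly_Mapping.keys f" "b \<in> Poly_Mapping.keys g'"
      "(a + b) - (n + p) \<in> N"
    | (right) a b where "a \<in> Poly_Mapping.keys g" "b \<in> Poly_Mapping.keys f'"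
      "(a + b) - (n + p) \<in> N"
    by (auto simp: keys_laurent_add keys_laurent_mult)
  then show False
  proof cases
    case left
    \<comment> \<open>The sum equals \<open>b - p\<close>, so \<open>g'\<close> would have an
      exponent above the leading exponent \<open>p\<close> of \<open>f'\<close>.\<close>
    then have "(n - a) + ((a + b) - (n + p)) \<in> N"
      using n(2) cone_add by blast
    then show False
      using left(2) p(3) by (simp add: algebra_simps)
  next
    case right
    then have "(p - b) + ((a + b) - (n + p)) \<in> N"
      using p(2) cone_add by blast
    then show False
      using right(1) n(3) by (simp add: algebra_simps)
  qed
qed

end

locale exponent_order = exponent_monoid E + exponent_cone N for E N
begin

lemma congruence_cone: "congruence A (cone_congruence E N)"
proof (rule congruenceI)
  fix f g h
  assume "(f, g) \<in> cone_congruence E N" "(g, h) \<in> cone_congruence E N"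
  then show "(f, h) \<in> cone_congruence E N"
    using dominated_trans[of f g h] dominated_trans[of h g f] by (simp add: cone_congruence_def)
next
  show "cone_congruence E N \<subseteq> carrier A \<times> carrier A"
    by (auto simp: cone_congruence_def)
qed (simp_all add: cone_congruence_def dominated_refl dominated_add dominated_mult
    laurent_add_closed laurent_mult_closed)

text \<open>If neither pair is related, each fails domination in some direction; in all four
  combinations the twisted product then fails it in one direction too.\<close>

lemma prime_cone_congruence: "prime_congruence A (cone_congruence E N)"
  unfolding prime_congruence_def
proof (intro conjI ballI impI)
  show "congruence A (cone_congruence E N)"
    by (fact congruence_cone)
  have "(1, 0) \<notin> cone_congruence E N"
    by (auto simp: cone_congruence_def dominated_def)
  moreover have "(1, 0) \<in> carrier A \<times> carrier A"
    using zero_exponent by simp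
  ultimately show "cone_congruence E N \<noteq> carrier A \<times> carrier A"
    by blast
next
  fix \<alpha> \<beta>
  assume \<alpha>: "\<alpha> \<in> carrier A \<times> carrier A" and \<beta>: "\<beta> \<in> carrier A \<times> carrier A"
    and tw: "twisted_product A \<alpha> \<beta> \<in> cone_congruence E N"
  obtain f g f' g' where fg: "\<alpha> = (f, g)" "\<beta> = (f', g')"
    by (cases \<alpha>, cases \<beta>)
  have tw': "dominated N (f * f' + g * g') (f * g' + g * f')"
    "dominated N (f * g' + g * f') (f * f' + g * g')"
    using tw by (auto simp: fg twisted_product_def cone_congruence_def)
  have "dominated N f g \<and> dominated N g f \<or> dominated N f' g' \<and> dominated N g' f'"
    using tw' not_dominated_twisted[of f g f' g'] not_dominated_twisted[of g f g' f']
      not_dominated_twisted[of f g g' f'] not_dominated_twisted[of g f f' g']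
    by (auto simp: add.commute)
  then show "\<alpha> \<in> cone_congruence E N \<or> \<beta> \<in> cone_congruence E N"
    using \<alpha> \<beta> by (auto simp: fg cone_congruence_def)
qed

lemma cone_congruence_generators:
  assumes "a \<in> E" "b \<in> E" "b - a \<in> N"
  shows "(monomial a + monomial b, monomial b) \<in> cone_congruence E N"
  using assms cone_zero by (auto simp: cone_congruence_def dominated_def keys_laurent_add)

end

section \<open>Chains of prime congruences above a cone\<close>

text \<open>Captures what is used of a prime above P[U]: for the full lexicographic cone, the
  required relations are the generators of P(U) with exponents in \<open>E\<close>.\<close>

locale cone_prime = exponent_order +
  fixes P
  assumes prime: "prime_congruence A P"
    and generators: "a \<in> E \<Longrightarrow> b \<in> E \<Longrightarrow> b - a \<in> N \<Longrightarrow>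
      (monomial a + monomial b, monomial b) \<in> P"
begin

lemma cong: "congruence A P"
  using prime by (simp add: prime_congruence_def)

lemmas P_carrier = congruence_carrier[OF cong, simplified]
lemmas P_refl = congruence_refl[OF cong, simplified]
lemmas P_sym = congruence_sym[OF cong]
lemmas P_trans [trans] = congruence_trans[OF cong]
lemmas P_add = congruence_add[OF cong, simplified]
lemmas P_mult = congruence_mult[OF cong, simplified]

lemma P_monomial_refl: "a \<in> E \<Longrightarrow> (monomial a, monomial a) \<in> P"
  by (simp add: P_refl)

lemma P_zero_refl: "(0, 0) \<in> P"
  by (simp add: P_refl)

lemma P_one_refl: "(1, 1) \<in> P"
  by (simp add: P_refl zero_exponent)

lemma one_zero_notin: "(1, 0) \<notin> P"
proof
  assume *: "(1, 0) \<in> P"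
  have zero: "(f, 0) \<in> P" if "Poly_Mapping.keys f \<subseteq> E" for f
    using P_mult[OF P_refl[OF that] *] by simp
  have "(f, g) \<in> P" if "Poly_Mapping.keys f \<subseteq> E" "Poly_Mapping.keys g \<subseteq> E" for f g
    using zero[OF that(1)] zero[OF that(2)] P_sym P_trans by blast
  then have "carrier A \<times> carrier A \<subseteq> P"
    by auto
  then have "P = carrier A \<times> carrier A"
    using equiv_type[OF congruence_equiv[OF cong]] by (rule subset_antisym[rotated])
  then show False
    using prime by (simp add: prime_congruence_def)
qed

text \<open>The twisted product of \<open>(f, g)\<close> and \<open>(h, 0)\<close> is
  \<open>(f * h, g * h)\<close>, so primality says that the quotient is cancellative.\<close>

lemma mult_cancel:
  assumes fgh: "(f * h, g * h) \<in> P" "(h, 0) \<notin> P"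
    and "Poly_Mapping.keys f \<subseteq> E" "Poly_Mapping.keys g \<subseteq> E" "Poly_Mapping.keys h \<subseteq> E"
  shows "(f, g) \<in> P"
proof -
  have "twisted_product A (f, g) (h, 0) \<in> P"
    using fgh by (simp add: twisted_product_def)
  moreover have "(f, g) \<in> carrier A \<times> carrier A" "(h, 0) \<in> carrier A \<times> carrier A"
    using assms by auto
  ultimately show ?thesis
    using prime assms(2) unfolding prime_congruence_def by blast
qed

lemma monomial_cancel:
  assumes "(monomial (a + c), monomial (b + c)) \<in> P" "(monomial c, 0) \<notin> P"
    and "a \<in> E" "b \<in> E" "c \<in> E"
  shows "(monomial a, monomial b) \<in> P"
  using mult_cancel[of "monomial a" "monomial c" "monomial b"] assms by (simp add: monomial_mult)

lemma monomial_mult_zero: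
  assumes "(monomial a, 0) \<in> P" "b \<in> E"
  shows "(monomial (a + b), 0) \<in> P"
  using P_mult[OF assms(1) P_monomial_refl[OF assms(2)]] by (simp add: monomial_mult)

text \<open>If \<open>monomial a\<close> were not congruent to 0 it could be cancelled repeatedly,
  ending with 1 congruent to 0.\<close>

lemma monomial_scale_zero:
  assumes "(monomial (of_nat m * a), 0) \<in> P" "a \<in> E"
  shows "(monomial a, 0) \<in> P"
  using assms
proof (induction m)
  case 0
  then show ?case
    using one_zero_notin by simp
next
  case (Suc m)
  show ?case
  proof (rule ccontr)
    assume *: "(monomial a, 0) \<notin> P"
    have "(monomial (of_nat m * a) * monomial a, 0 * monomial a) \<in> P"
      using Suc.prems by (simp add: monomial_mult distrib_right add.commute)
    then have "(monomial (of_nat m * a), 0) \<in> P"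
      using mult_cancel[of "monomial (of_nat m * a)" "monomial a" 0] * Suc.prems scale_exponent
      by simp
    then show False
      using Suc * by blast
  qed
qed

lemma monomial_scale_congruent:
  assumes "(monomial a, monomial b) \<in> P"
  shows "(monomial (of_nat m * a), monomial (of_nat m * b)) \<in> P"
proof (induction m)
  case 0
  then show ?case
    using P_one_refl by simp
next
  case (Suc m)
  then show ?case
    using P_mult[OF assms Suc] by (simp add: monomial_mult distrib_right)
qed

text \<open>Adding a monomial congruent to 0 changes nothing modulo \<open>P\<close>, yet the larger
  monomial absorbs the smaller one.\<close>

lemma monomial_zero_downward:
  assumes "(monomial b, 0) \<in> P" "a \<in> E" "b \<in> E" "b - a \<in> N"
  shows "(monomial a, 0) \<in> P"
proof -
  have "(monomial a, monomial a + monomial b) \<in> P"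
    using P_add[OF P_monomial_refl[OF assms(2)] P_sym[OF assms(1)]] by simp
  also have "(monomial a + monomial b, monomial b) \<in> P"
    using generators assms by blast
  also note assms(1)
  finally show ?thesis .
qed

text \<open>The quotient is ordered by \<open>x \<le> y\<close> iff \<open>x + y = y\<close>. The
  generators compare the two classes in one direction through \<open>a\<close>, \<open>b\<close> and
  in the other through \<open>a'\<close>, \<open>b'\<close>, and this order is
  antisymmetric.\<close>

lemma monomial_antisym:
  assumes "(monomial a, monomial a') \<in> P" "(monomial b, monomial b') \<in> P"
    and "a \<in> E" "b \<in> E" "a' \<in> E" "b' \<in> E" "b - a \<in> N" "a' - b' \<in> N"
  shows "(monomial a, monomial b) \<in> P"
proof -
  have "(monomial a, monomial a') \<in> P" by fact
  also have "(monomial a', monomial b' + monomial a') \<in> P"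
    using generators[of b' a'] assms P_sym by blast
  also have "(monomial b' + monomial a', monomial b + monomial a) \<in> P"
    by (rule P_add[OF P_sym[OF assms(2)] P_sym[OF assms(1)]])
  also have "(monomial b + monomial a, monomial b) \<in> P"
    using generators[of a b] assms by (simp add: add.commute)
  finally show ?thesis .
qed

text \<open>Every term lies below the leading one, so the generators absorb the terms one at a
  time.\<close>

lemma congruent_leading_monomial:
  assumes f: "Poly_Mapping.keys f \<subseteq> E" "f \<noteq> 0"
  obtains m where "m \<in> E" "(f, monomial m) \<in> P"
proof -
  obtain m where m: "m \<in> Poly_Mapping.keys f" "\<forall>n\<in>Poly_Mapping.keys f. m - n \<in> N"
    using cone_greatest[of "Poly_Mapping.keys f"] f by auto
  \<comment> \<open>The separate summand \<open>monomial m\<close> gives the induction its base; it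
    disappears at the end because \<open>f\<close> already contains it.\<close>
  have sum: "((\<Sum>n\<in>S. monomial n) + monomial m, monomial m) \<in> P"
    if "finite S" "S \<subseteq> Poly_Mapping.keys f" for S
    using that
  proof (induction S rule: finite_induct)
    case empty
    show ?case
      using P_monomial_refl m f by auto
  next
    case (insert n S)
    have "(monomial n + ((\<Sum>n\<in>S. monomial n) + monomial m), monomial n + monomial m) \<in> P"
      using insert f by (intro P_add P_monomial_refl) auto
    also have "(monomial n + monomial m, monomial m) \<in> P"
      using insert f m by (intro generators) auto
    finally show ?case
      using insert by (simp add: add.assoc)
  qed
  have "f = (\<Sum>n\<in>Poly_Mapping.keys f. monomial n)"
  proof (rule poly_mapping_eqI)
    fix i
    have "Poly_Mapping.lookup (\<Sum>n\<in>Poly_Mapping.keys f. monomial n) i =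
        (\<Sum>n\<in>Poly_Mapping.keys f. if i = n then 1 else 0)"
      by (auto simp: lookup_sum lookup_single when_def intro!: sum.cong)
    then show "Poly_Mapping.lookup f i = Poly_Mapping.lookup (\<Sum>n\<in>Poly_Mapping.keys f. monomial n) i"
      by (simp add: in_keys_iff boolean_semifield_eq_1_iff)
  qed
  then have "(f + monomial m, monomial m) \<in> P"
    using sum[of "Poly_Mapping.keys f"] by simp
  moreover have "f + monomial m = f"
    using monomial_add_absorb[OF m(1)] by (simp add: add.commute)
  ultimately show thesis
    using that[of m] m f by auto
qed

end

context exponent_order
begin

text \<open>Witnesses of a strict inclusion \<open>P \<subset> P'\<close>. The first alternative is that \<open>P'\<close> has more elements
  congruent to \<open>0\<close>; otherwise the quotient by \<open>P'\<close> identifies more monomials.\<close>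

definition separating_pair where
  "separating_pair P P' b c \<longleftrightarrow> b \<in> E \<and> c \<in> E \<and> c - b \<notin> N \<and>
    (monomial b, monomial c) \<notin> P \<and> (monomial c, 0) \<notin> P \<and>
    (b = 0 \<and> (monomial c, 0) \<in> P' \<or> (monomial c, 0) \<notin> P' \<and> (monomial b, monomial c) \<in> P')"

text \<open>If \<open>P'\<close> kills a monomial that \<open>P\<close> does not, that monomial is
  paired with 1. Otherwise a pair in \<open>P'\<close> but not in \<open>P\<close> is replaced by
  leading monomials modulo \<open>P\<close>.\<close>

lemma separating_pair_exists:
  assumes "cone_prime E N P" "cone_prime E N P'" and "P \<subset> P'"
  shows "\<exists>b c. separating_pair P P' b c"
proof (cases "\<exists>a\<in>E. (monomial a, 0) \<in> P' \<and> (monomial a, 0) \<notin> P")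
  case True
  interpret P: cone_prime E N P by fact
  interpret P': cone_prime E N P' by fact
  from True obtain a where a: "a \<in> E" "(monomial a, 0) \<in> P'" "(monomial a, 0) \<notin> P"
    by blast
  \<comment> \<open>If \<open>a\<close> were above the exponent 0, then \<open>P'\<close> would
    identify 1 with 0.\<close>
  have "a - 0 \<notin> N"
    using P'.monomial_zero_downward[of a 0] a zero_exponent P'.one_zero_notin by auto
  moreover have "(monomial 0, monomial a) \<notin> P'"
    using P'.P_trans[OF _ a(2), of 1] P'.one_zero_notin by auto
  ultimately have "separating_pair P P' 0 a"
    using a \<open>P \<subset> P'\<close> zero_exponent by (auto simp: separating_pair_def)
  then show ?thesis
    by blast
next
  case False
  interpret P: cone_prime E N P by fact
  interpret P': cone_prime E N P' by fact
  have PP': "P \<subseteq> P'"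
    using \<open>P \<subset> P'\<close> by blast
  have zero: "(f, 0) \<in> P" if f: "(f, 0) \<in> P'" for f
  proof (cases "f = 0")
    case True
    then show ?thesis
      by (simp add: P.P_zero_refl)
  next
    case nz: False
    obtain m where m: "m \<in> E" "(f, monomial m) \<in> P"
      using P.congruent_leading_monomial[of f] P'.P_carrier[OF f] nz by blast
    then have "(monomial m, 0) \<in> P'"
      using f PP' P'.P_sym P'.P_trans by blast
    then have "(monomial m, 0) \<in> P"
      using False m by blast
    then show ?thesis
      using m P.P_trans by blast
  qed
  obtain f g where fg: "(f, g) \<in> P'" "(f, g) \<notin> P"
    using \<open>P \<subset> P'\<close> by auto
  have "f \<noteq> 0" "g \<noteq> 0"
    using fg zero P.P_sym P'.P_sym by blast+
  then obtain a b where a: "a \<in> E" "(f, monomial a) \<in> P" and b: "b \<in> E" "(g, monomial b) \<in> P"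
    using P.congruent_leading_monomial P'.P_carrier[OF fg(1)] by metis
  have ab: "(monomial a, monomial b) \<in> P'"
    using a b fg PP' P'.P_sym P'.P_trans by blast
  have nab: "(monomial a, monomial b) \<notin> P"
    using a b fg P.P_sym P.P_trans by blast
  have na: "(monomial a, 0) \<notin> P'" and nb: "(monomial b, 0) \<notin> P'"
    using ab nab zero P'.P_sym P'.P_trans P.P_sym P.P_trans by meson+
  \<comment> \<open>Equivalent exponents are already identified by the generators, so one of the two
    is strictly greater; it comes first in the pair.\<close>
  have "b - a \<notin> N \<or> a - b \<notin> N"
    using nab P.monomial_antisym[of a a b b] a b P.P_monomial_refl by blast
  then have "separating_pair P P' a b \<or> separating_pair P P' b a"
    using a b ab nab na nb PP' P.P_sym P'.P_sym unfolding separating_pair_def by blast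
  then show ?thesis
    by blast
qed

text \<open>Meant for steps from \<open>P\<close> to \<open>P'\<close> and, later, from
  \<open>Q\<close> to \<open>Q'\<close>. Archimedean equivalence forces into \<open>P'\<close> a
  relation that the later pair forbids in \<open>Q\<close>: \<open>arch1\<close> kills
  \<open>c'\<close> in the first case, \<open>arch2\<close> identifies \<open>b'\<close> and
  \<open>c'\<close> in the second.\<close>

lemma separating_pairs_not_archimedean:
  assumes "cone_prime E N P'" "P' \<subseteq> Q"
    and sep: "separating_pair P P' b c" "separating_pair Q Q' b' c'"
    and arch1: "of_nat m * (b' - c') - (b - c) \<in> N"
    and arch2: "of_nat l * (b - c) - (b' - c') \<in> N"
  shows False
proof -
  interpret P': cone_prime E N P' by fact
  have E: "b \<in> E" "c \<in> E" "b' \<in> E" "c' \<in> E"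
    using sep by (auto simp: separating_pair_def)
  consider (zero) "b = 0" "(monomial c, 0) \<in> P'"
    | (nonzero) "(monomial c, 0) \<notin> P'" "(monomial b, monomial c) \<in> P'"
    using sep(1) by (auto simp: separating_pair_def)
  then show False
  proof cases
    case zero
    have "(monomial (c + of_nat m * b'), 0) \<in> P'"
      using zero E scale_exponent by (intro P'.monomial_mult_zero) auto
    moreover have "(c + of_nat m * b') - of_nat m * c' \<in> N"
      using arch1 zero by (simp add: algebra_simps)
    ultimately have "(monomial (of_nat m * c'), 0) \<in> P'"
      using P'.monomial_zero_downward E scale_exponent add_exponent by meson
    then have "(monomial c', 0) \<in> P'"
      using P'.monomial_scale_zero E by blast
    then show False
      using sep(2) \<open>P' \<subseteq> Q\<close> by (auto simp: separating_pair_def)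
  next
    case nonzero
    define d where "d = of_nat l * c"
    define e where "e = of_nat l * b"
    have de: "d \<in> E" "e \<in> E"
      using E by (auto simp: d_def e_def scale_exponent)
    have "(monomial c' * monomial e, monomial c' * monomial d) \<in> P'"
      using nonzero(2) E P'.monomial_scale_congruent
      unfolding d_def e_def by (intro P'.P_mult P'.P_monomial_refl) auto
    then have ed: "(monomial (c' + d), monomial (c' + e)) \<in> P'"
      by (simp add: monomial_mult P'.P_sym)
    \<comment> \<open>As \<open>c'\<close> lies below \<open>b'\<close>, this squeezes
      \<open>b' + d\<close> between \<open>c' + d\<close> and \<open>c' + e\<close>, whose monomials
      \<open>P'\<close> identifies. Then \<open>d\<close> is cancelled, since \<open>P'\<close> does
      not kill \<open>c\<close>.\<close>
    have le: "(c' + e) - (b' + d) \<in> N"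
      using arch2 by (simp add: d_def e_def algebra_simps)
    have "c' - b' \<notin> N"
      using sep(2) by (simp add: separating_pair_def)
    then have "(b' + d) - (c' + d) \<in> N"
      using cone_linear[of b' c'] by simp
    then have "(monomial (c' + d), monomial (b' + d)) \<in> P'"
      using P'.monomial_antisym[OF ed P'.P_monomial_refl[of "b' + d"]] le E de add_exponent by blast
    then have "(monomial c', monomial b') \<in> P'"
      using P'.monomial_cancel[of c' d b'] E de nonzero P'.monomial_scale_zero[of l c]
      by (auto simp: d_def)
    then show False
      using sep(2) \<open>P' \<subseteq> Q\<close> P'.P_sym by (auto simp: separating_pair_def)
  qed
qed

end

section \<open>Lexicographic cones\<close>

text \<open>Coordinate \<open>i\<close> of the product of \<open>U\<close> and \<open>d\<close>, as
  an additive function of \<open>d\<close> that can be handled without vectors.\<close>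

definition row_form :: "real mat \<Rightarrow> nat \<Rightarrow> (nat \<Rightarrow>\<^sub>0 int) \<Rightarrow> real" where
  "row_form U i d = (\<Sum>j<dim_col U. U $$ (i, j) * real_of_int (Poly_Mapping.lookup d j))"

lemma mat_mult_exponent_row_form:
  "i < dim_row U \<Longrightarrow> mat_mult_exponent U d $ i = row_form U i d"
  by (simp add: mat_mult_exponent_def row_form_def scalar_prod_def lessThan_atLeast0)

lemma dim_mat_mult_exponent [simp]: "dim_vec (mat_mult_exponent U d) = dim_row U"
  by (simp add: mat_mult_exponent_def)

lemma row_form_zero [simp]: "row_form U i 0 = 0"
  by (simp add: row_form_def)

lemma row_form_add [simp]: "row_form U i (a + b) = row_form U i a + row_form U i b"
  by (simp add: row_form_def lookup_add algebra_simps sum.distrib)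

lemma row_form_minus [simp]: "row_form U i (- a) = - row_form U i a"
  by (simp add: row_form_def sum_negf)

lemma row_form_diff [simp]: "row_form U i (a - b) = row_form U i a - row_form U i b"
  using row_form_add[of U i a "- b"] by simp

lemma row_form_scale [simp]: "row_form U i (of_nat m * a) = real m * row_form U i a"
  by (induction m) (auto simp: algebra_simps)

text \<open>The lexicographic preorder of the first \<open>s\<close> rows:
  \<open>s = dim_row U\<close> gives the order in the definition of P(U), smaller \<open>s\<close>
  coarser ones, and \<open>s = 0\<close> makes all exponents equivalent.\<close>

definition lex_cone :: "real mat \<Rightarrow> nat \<Rightarrow> (nat \<Rightarrow>\<^sub>0 int) set" where
  "lex_cone U s = {d. (\<forall>i<s. row_form U i d = 0) \<or>
    (\<exists>i<s. 0 < row_form U i d \<and> (\<forall>j<i. row_form U j d = 0))}"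

lemma lex_cone_cases:
  obtains "\<forall>i<s. row_form U i d = 0"
  | i where "i < s" "row_form U i d \<noteq> 0" "\<forall>j<i. row_form U j d = 0"
proof (cases "\<forall>i<s. row_form U i d = 0")
  case False
  then obtain i where "i < s \<and> row_form U i d \<noteq> 0" "\<forall>j<i. \<not> (j < s \<and> row_form U j d \<noteq> 0)"
    using exists_least_iff[of "\<lambda>i. i < s \<and> row_form U i d \<noteq> 0"] by blast
  then show thesis
    using that(2) by (meson less_trans)
qed (use that in blast)

lemma lex_cone_cong:
  assumes "\<And>i. i < s \<Longrightarrow> row_form U i a = row_form U i b"
  shows "a \<in> lex_cone U s \<longleftrightarrow> b \<in> lex_cone U s"
proof -
  have "0 < row_form U i a \<and> (\<forall>j<i. row_form U j a = 0) \<longleftrightarrow>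
      0 < row_form U i b \<and> (\<forall>j<i. row_form U j b = 0)" if "i < s" for i
    using assms that by simp
  then have "(\<exists>i<s. 0 < row_form U i a \<and> (\<forall>j<i. row_form U j a = 0)) \<longleftrightarrow>
      (\<exists>i<s. 0 < row_form U i b \<and> (\<forall>j<i. row_form U j b = 0))"
    by blast
  then show ?thesis
    using assms by (simp add: lex_cone_def)
qed

lemma lex_cone_add:
  assumes "a \<in> lex_cone U s" "b \<in> lex_cone U s"
  shows "a + b \<in> lex_cone U s"
proof (cases "(\<forall>i<s. row_form U i a = 0) \<or> (\<forall>i<s. row_form U i b = 0)")
  case True
  then show ?thesis
    using assms lex_cone_cong[of s U "a + b" a] lex_cone_cong[of s U "a + b" b] by auto
next
  case False
  then obtain i j where i: "i < s" "0 < row_form U i a" "\<forall>l<i. row_form U l a = 0"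
    and j: "j < s" "0 < row_form U j b" "\<forall>l<j. row_form U l b = 0"
    using assms by (auto simp: lex_cone_def)
  \<comment> \<open>At the smaller leading index one coordinate is positive and the other is
    positive or zero.\<close>
  have "0 < row_form U (min i j) (a + b)"
    using i j by (cases i j rule: linorder_cases) (auto simp: min_def)
  moreover have "\<forall>l<min i j. row_form U l (a + b) = 0"
    using i j by simp
  moreover have "min i j < s"
    using i by simp
  ultimately show ?thesis
    unfolding lex_cone_def by blast
qed

lemma exponent_cone_lex: "exponent_cone (lex_cone U s)"
proof
  show "a \<in> lex_cone U s \<or> - a \<in> lex_cone U s" for a
    by (rule lex_cone_cases[of s U a])
      (auto simp: lex_cone_def, metis linorder_neqE_linordered_idom neg_0_less_iff_less)
qed (simp_all add: lex_cone_add, simp add: lex_cone_def)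

lemma lex_cone_mono: "lex_cone U (Suc s) \<subseteq> lex_cone U s"
  by (auto simp: lex_cone_def less_Suc_eq)

text \<open>An exponent led by row \<open>s\<close> is equivalent to 0 until that row is taken into
  account. This makes consecutive cone congruences differ.\<close>

lemma lex_cone_Suc_pure:
  assumes "first_nonzero_at (mat_mult_exponent U n) s"
  shows "n \<in> lex_cone U s" "- n \<in> lex_cone U s"
    "n \<notin> lex_cone U (Suc s) \<or> - n \<notin> lex_cone U (Suc s)"
proof -
  have s: "s < dim_row U" "row_form U s n \<noteq> 0" "\<forall>j<s. row_form U j n = 0"
    using assms by (auto simp: first_nonzero_at_def mat_mult_exponent_row_form)
  then show "n \<in> lex_cone U s" "- n \<in> lex_cone U s"
    by (simp_all add: lex_cone_def)
  show "n \<notin> lex_cone U (Suc s) \<or> - n \<notin> lex_cone U (Suc s)"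
    using s by (force simp: lex_cone_def less_Suc_eq)
qed

lemma lex_cone_iff_first_nonzero:
  "d \<in> lex_cone U (dim_row U) \<longleftrightarrow>
    (let v = mat_mult_exponent U d
     in v = 0\<^sub>v (dim_row U) \<or> (\<exists>i. first_nonzero_at v i \<and> 0 < v $ i))"
proof -
  have "mat_mult_exponent U d = 0\<^sub>v (dim_row U) \<longleftrightarrow> (\<forall>i<dim_row U. row_form U i d = 0)"
    by (auto simp: vec_eq_iff mat_mult_exponent_row_form)
  moreover have "first_nonzero_at (mat_mult_exponent U d) i \<and> 0 < mat_mult_exponent U d $ i \<longleftrightarrow>
      i < dim_row U \<and> 0 < row_form U i d \<and> (\<forall>j<i. row_form U j d = 0)" for i
    by (auto simp: first_nonzero_at_def mat_mult_exponent_row_form)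
  ultimately show ?thesis
    by (auto simp: lex_cone_def Let_def)
qed

text \<open>The leading coordinate exists and cannot be negative. Its index \<open>i\<close>
  represents the archimedean class of \<open>d\<close>.\<close>

lemma lex_cone_positive_level:
  assumes "- d \<notin> lex_cone U s"
  shows "\<exists>i<s. 0 < row_form U i d \<and> (\<forall>j<i. row_form U j d = 0)"
proof (rule lex_cone_cases[of s U d])
  fix i
  assume i: "i < s" "row_form U i d \<noteq> 0" "\<forall>j<i. row_form U j d = 0"
  then have "\<not> row_form U i d < 0"
    using assms by (auto simp: lex_cone_def)
  then show ?thesis
    using i by (auto intro!: exI[of _ i])
qed (use assms in \<open>auto simp: lex_cone_def\<close>)

text \<open>All rows before \<open>i\<close> vanish, so row \<open>i\<close> decides, and there the
  real numbers are archimedean.\<close>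

lemma lex_cone_archimedean:
  assumes "i < s" "0 < row_form U i d" "\<forall>j<i. row_form U j d = 0" "\<forall>j<i. row_form U j e = 0"
  shows "\<exists>m. of_nat m * d - e \<in> lex_cone U s"
proof -
  obtain m where "row_form U i e < real m * row_form U i d"
    using reals_Archimedean3[OF assms(2)] by blast
  then have "of_nat m * d - e \<in> lex_cone U s"
    using assms by (auto simp: lex_cone_def intro!: exI[of _ i])
  then show ?thesis ..
qed

section \<open>The dimension\<close>

lemma congruence_Inter:
  assumes "F \<noteq> {}" and cong: "\<And>I. I \<in> F \<Longrightarrow> congruence A I"
  shows "congruence A (\<Inter>F)"
proof (rule congruenceI)
  show "\<Inter>F \<subseteq> carrier A \<times> carrier A"
    using assms congruence_carrier by fast
next
  fix a b c
  assume "(a, b) \<in> \<Inter>F" "(b, c) \<in> \<Inter>F"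
  then show "(a, c) \<in> \<Inter>F"
    using congruence_trans[OF cong, of _ a b c] by blast
next
  fix a b
  assume "(a, b) \<in> \<Inter>F"
  then show "(b, a) \<in> \<Inter>F"
    using congruence_sym[OF cong, of _ a b] by blast
qed (auto intro: congruence_refl[OF cong] congruence_add[OF cong] congruence_mult[OF cong])

text \<open>The congruence \<open>J\<close> makes the intersected family non-empty, which keeps the
  intersection inside the carrier.\<close>

lemma generated_congruence:
  assumes "congruence A J" "S \<subseteq> J"
  shows congruence_generated_congruence: "congruence A (generated_congruence A S)"
    and generated_congruence_contains: "S \<subseteq> generated_congruence A S"
    and generated_congruence_least: "generated_congruence A S \<subseteq> J"
proof -
  show least: "generated_congruence A S \<subseteq> J"
    using assms by (auto simp: generated_congruence_def)
  show "S \<subseteq> generated_congruence A S"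
    by (auto simp: generated_congruence_def)
  show "congruence A (generated_congruence A S)"
    unfolding generated_congruence_def using assms by (intro congruence_Inter) auto
qed

lemma congruence_restrict:
  assumes "congruence (monomial_semiring E) I" "exponent_monoid E'" "E' \<subseteq> E"
  shows "congruence (monomial_semiring E')
    (I \<inter> (carrier (monomial_semiring E') \<times> carrier (monomial_semiring E')))"
proof -
  interpret exponent_monoid E' by fact
  show ?thesis
  proof (rule congruenceI)
    fix a b c
    assume "(a, b) \<in> I \<inter> (carrier A \<times> carrier A)" "(b, c) \<in> I \<inter> (carrier A \<times> carrier A)"
    then show "(a, c) \<in> I \<inter> (carrier A \<times> carrier A)"
      using congruence_trans[OF assms(1)] by blast
  next
    fix a
    assume "a \<in> carrier A"
    then show "(a, a) \<in> I \<inter> (carrier A \<times> carrier A)"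
      using congruence_refl[OF assms(1), of a] assms(3) by auto
  next
    fix a b
    assume "(a, b) \<in> I \<inter> (carrier A \<times> carrier A)"
    then show "(b, a) \<in> I \<inter> (carrier A \<times> carrier A)"
      using congruence_sym[OF assms(1)] by blast
  next
    fix a b c d
    assume "(a, b) \<in> I \<inter> (carrier A \<times> carrier A)" "(c, d) \<in> I \<inter> (carrier A \<times> carrier A)"
    then show "(a \<oplus>\<^bsub>A\<^esub> c, b \<oplus>\<^bsub>A\<^esub> d) \<in> I \<inter> (carrier A \<times> carrier A)"
      "(a \<otimes>\<^bsub>A\<^esub> c, b \<otimes>\<^bsub>A\<^esub> d) \<in> I \<inter> (carrier A \<times> carrier A)"
      using congruence_add[OF assms(1), of a b c d] congruence_mult[OF assms(1), of a b c d]
      by (simp_all add: laurent_add_closed laurent_mult_closed)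
  qed blast
qed

section \<open>Laurent and polynomial exponents\<close>

definition natural_exponents :: "nat \<Rightarrow> (nat \<Rightarrow>\<^sub>0 int) set" where
  "natural_exponents k = {n \<in> exponents k. \<forall>i. 0 \<le> Poly_Mapping.lookup n i}"

lemma laurent_semiring_monomial: "laurent_semiring k = monomial_semiring (exponents k)"
  by (simp add: laurent_semiring_def monomial_semiring_def)

lemma polynomial_semiring_monomial:
  "polynomial_semiring k = monomial_semiring (natural_exponents k)"
  by (simp add: polynomial_semiring_def monomial_semiring_def natural_exponents_def)

lemma exponent_monoid_exponents: "exponent_monoid (exponents k)"
proof
  show "a + b \<in> exponents k" if "a \<in> exponents k" "b \<in> exponents k" for a b
    using that Poly_Mapping.keys_add[of a b] unfolding exponents_def by blast
qed (simp add: exponents_def)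

lemma exponent_monoid_natural_exponents: "exponent_monoid (natural_exponents k)"
  using exponent_monoid_exponents[of k]
  by (auto simp: exponent_monoid_def natural_exponents_def lookup_add)

text \<open>Positive and negative parts. This turns the integer vectors given by admissibility into
  pairs of polynomial monomials.\<close>

lemma natural_exponents_difference:
  assumes "n \<in> exponents k"
  obtains a b where "a \<in> natural_exponents k" "b \<in> natural_exponents k" "n = a - b"
proof
  define pos where "pos d = Poly_Mapping.map (\<lambda>x. max x 0) d" for d :: "nat \<Rightarrow>\<^sub>0 int"
  have lookup: "Poly_Mapping.lookup (pos d) i = max (Poly_Mapping.lookup d i) 0" for d i
    by (simp add: pos_def map.rep_eq when_def)
  have nat: "pos d \<in> natural_exponents k" if "d \<in> exponents k" for d
    using that by (auto simp: natural_exponents_def exponents_def lookup in_keys_iff subset_iff)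
  show "pos n \<in> natural_exponents k" "pos (- n) \<in> natural_exponents k"
    using assms by (auto intro!: nat simp: exponents_def)
  show "n = pos n - pos (- n)"
    by (rule poly_mapping_eqI) (simp add: lookup lookup_minus max_def)
qed

section \<open>Bounds for chains of primes above P[U]\<close>

context
  fixes U :: "real mat" and k :: nat
  assumes k: "dim_col U = k"
begin

lemma exponent_order_natural_lex: "exponent_order (natural_exponents k) (lex_cone U s)"
  by (intro exponent_order.intro exponent_monoid_natural_exponents exponent_cone_lex)

lemma exponent_order_lex: "exponent_order (exponents k) (lex_cone U s)"
  by (intro exponent_order.intro exponent_monoid_exponents exponent_cone_lex)

lemma laurent_congruence_lex:
  "laurent_congruence U = generated_congruence (monomial_semiring (exponents k))
    {(monomial a + monomial b, monomial b) | a b.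
      a \<in> exponents k \<and> b \<in> exponents k \<and> b - a \<in> lex_cone U (dim_row U)}"
  unfolding laurent_congruence_def lex_cone_iff_first_nonzero k laurent_semiring_monomial ..

lemma laurent_generators_cone:
  "{(monomial a + monomial b, monomial b) | a b.
      a \<in> exponents k \<and> b \<in> exponents k \<and> b - a \<in> lex_cone U (dim_row U)}
    \<subseteq> cone_congruence (exponents k) (lex_cone U (dim_row U))"
  using exponent_order.cone_congruence_generators[OF exponent_order_lex] by blast

lemmas laurent_congruence_facts =
  generated_congruence[OF exponent_order.congruence_cone[OF exponent_order_lex]
    laurent_generators_cone, folded laurent_congruence_lex]

lemma polynomial_congruence_eq:
  "polynomial_congruence U = laurent_congruence U \<inter>
    (carrier (monomial_semiring (natural_exponents k)) \<times>
     carrier (monomial_semiring (natural_exponents k)))"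
  by (simp only: polynomial_congruence_def k polynomial_semiring_monomial)

lemma congruence_polynomial_congruence:
  "congruence (polynomial_semiring k) (polynomial_congruence U)"
  unfolding polynomial_congruence_eq polynomial_semiring_monomial
  by (rule congruence_restrict[OF laurent_congruence_facts(1) exponent_monoid_natural_exponents])
    (auto simp: natural_exponents_def)

text \<open>P[U] is defined by intersection, not by generators; this supplies the relations that
  \<open>cone_prime\<close> asks of every prime above it.\<close>

lemma polynomial_congruence_generators:
  assumes "a \<in> natural_exponents k" "b \<in> natural_exponents k" "b - a \<in> lex_cone U (dim_row U)"
  shows "(monomial a + monomial b, monomial b) \<in> polynomial_congruence U"
proof -
  have "(monomial a + monomial b, monomial b) \<in> laurent_congruence U"
    using assms laurent_congruence_facts(2) by (auto simp: natural_exponents_def)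
  then show ?thesis
    using assms by (auto simp: polynomial_congruence_eq keys_laurent_add)
qed

text \<open>The Laurent cone congruence contains the generators of P(U), hence P(U), and domination
  does not depend on the ambient set of exponents.\<close>

lemma polynomial_congruence_le_cone:
  "polynomial_congruence U \<subseteq> cone_congruence (natural_exponents k) (lex_cone U (dim_row U))"
  using laurent_congruence_facts(3)
  by (fastforce simp: polynomial_congruence_eq cone_congruence_def)

text \<open>Each step forgets the last remaining row. Admissibility provides an exponent led by that
  row, which makes the inclusion strict.\<close>

lemma prime_chain_lex_cones:
  assumes "admissible U"
  shows "prime_chain (polynomial_semiring k) (dim_row U)
    (\<lambda>i. cone_congruence (natural_exponents k) (lex_cone U (dim_row U - i)))"
  unfolding prime_chain_def
proof (intro conjI allI impI)
  show "prime_congruence (polynomial_semiring k)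
      (cone_congruence (natural_exponents k) (lex_cone U (dim_row U - i)))" for i
    unfolding polynomial_semiring_monomial
    by (rule exponent_order.prime_cone_congruence[OF exponent_order_natural_lex])
next
  fix i
  assume i: "i < dim_row U"
  \<comment> \<open>\<open>s\<close> is the index, counted from 0, of the row forgotten between
    positions \<open>i\<close> and \<open>Suc i\<close>.\<close>
  define s where "s = dim_row U - Suc i"
  have s: "dim_row U - i = Suc s" "s < dim_row U"
    using i by (auto simp: s_def)
  obtain n where n: "n \<in> exponents k" "first_nonzero_at (mat_mult_exponent U n) s"
    using assms s k by (auto simp: admissible_def)
  obtain a b where ab: "a \<in> natural_exponents k" "b \<in> natural_exponents k" "n = a - b"
    using natural_exponents_difference[OF n(1)] .
  then have "(monomial a, monomial b) \<in> cone_congruence (natural_exponents k) (lex_cone U s)"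
    "(monomial a, monomial b) \<notin> cone_congruence (natural_exponents k) (lex_cone U (Suc s))"
    using lex_cone_Suc_pure[OF n(2)] by (auto simp: monomial_cone_congruence_iff)
  then show "cone_congruence (natural_exponents k) (lex_cone U (dim_row U - i)) \<subset>
      cone_congruence (natural_exponents k) (lex_cone U (dim_row U - Suc i))"
    using cone_congruence_mono[OF lex_cone_mono] s by (metis psubsetI s_def)
qed

text \<open>Each step of the chain is assigned the leading row \<open>l i\<close> of a separating
  difference; this assignment is injective.\<close>

lemma prime_chain_length_le:
  assumes C: "prime_chain (polynomial_semiring k) n C" and "polynomial_congruence U \<subseteq> C 0"
  shows "n \<le> dim_row U"
proof -
  define E where "E = natural_exponents k"
  define N where "N = lex_cone U (dim_row U)"
  interpret exponent_order E N
    unfolding E_def N_def by (rule exponent_order_natural_lex)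
  have prime: "cone_prime E N (C i)" if "i \<le> n" for i
  proof
    show "prime_congruence A (C i)"
      using C that by (simp add: prime_chain_def polynomial_semiring_monomial E_def)
    show "(monomial a + monomial b, monomial b) \<in> C i"
      if "a \<in> E" "b \<in> E" "b - a \<in> N" for a b
      using that polynomial_congruence_generators assms(2)
        prime_chain_subset[OF congruence_polynomial_congruence C, of 0 i] \<open>i \<le> n\<close>
      unfolding E_def N_def by blast
  qed
  have "\<exists>b c. separating_pair (C i) (C (Suc i)) b c" if "i < n" for i
    using that C by (intro separating_pair_exists prime) (auto simp: prime_chain_def)
  then obtain b c where sep: "\<And>i. i < n \<Longrightarrow> separating_pair (C i) (C (Suc i)) (b i) (c i)"
    by metis
  have "\<exists>l<dim_row U. 0 < row_form U l (b i - c i) \<and> (\<forall>j<l. row_form U j (b i - c i) = 0)"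
    if "i < n" for i
    using sep[OF that] by (intro lex_cone_positive_level) (simp add: separating_pair_def flip: N_def)
  then obtain l where l: "\<And>i. i < n \<Longrightarrow> l i < dim_row U"
    "\<And>i. i < n \<Longrightarrow> 0 < row_form U (l i) (b i - c i)"
    "\<And>i. i < n \<Longrightarrow> \<forall>j<l i. row_form U j (b i - c i) = 0"
    by metis
  \<comment> \<open>With equal leading rows, each difference is exceeded by a multiple of the other,
    which is impossible for two steps of one chain.\<close>
  have False if "i < j" "j < n" "l i = l j" for i j
  proof -
    have "\<exists>m. of_nat m * (b j - c j) - (b i - c i) \<in> N"
      unfolding N_def using l[of i] l[of j] that by (intro lex_cone_archimedean) auto
    moreover have "\<exists>m. of_nat m * (b i - c i) - (b j - c j) \<in> N"
      unfolding N_def using l[of i] l[of j] that by (intro lex_cone_archimedean) auto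
    moreover have "C (Suc i) \<subseteq> C j"
      using prime_chain_subset[OF congruence_polynomial_congruence C, of "Suc i" j] that by simp
    ultimately show False
      using separating_pairs_not_archimedean[OF prime[of "Suc i"] _ sep[of i] sep[of j]] that by auto
  qed
  then have "inj_on l {..<n}"
    by (metis inj_onI lessThan_iff linorder_neqE_nat)
  then show "n \<le> dim_row U"
    using card_inj_on_le[of l "{..<n}" "{..<dim_row U}"] l(1) by auto
qed

end

theorem proposition4p8:
  fixes U :: "real mat" and k :: nat
  assumes "dim_col U = k" and "admissible U"
  shows "congruence_dim (quotient_semiring (polynomial_semiring k) (polynomial_congruence U))
    = ereal (real (dim_row U))"
proof -
  let ?Q = "quotient_semiring (polynomial_semiring k) (polynomial_congruence U)"
  have chain: "(\<exists>C. prime_chain ?Q n C) \<longleftrightarrow>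
      (\<exists>C. prime_chain (polynomial_semiring k) n C \<and> polynomial_congruence U \<subseteq> C 0)" for n
    by (rule prime_chain_quotient_iff[OF congruence_polynomial_congruence[OF assms(1)]])
  have "\<exists>C. prime_chain ?Q (dim_row U) C"
    unfolding chain
    using prime_chain_lex_cones[OF assms] polynomial_congruence_le_cone[OF assms(1)]
    by (intro exI[of _ "\<lambda>i. cone_congruence (natural_exponents k) (lex_cone U (dim_row U - i))"]) simp
  moreover have "n \<le> dim_row U" if "prime_chain ?Q n C" for n C
    using that chain prime_chain_length_le[OF assms(1)] by blast
  ultimately show ?thesis
    unfolding congruence_dim_def by (intro Sup_eqI) auto
qed

end
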